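(* Let $(\mathcal{S}^x,H)$ be a finite elation generalized quadrangle of order $(t^2,t)$ satisfying property ( * ). Then $(\mathcal{S}^x,H)$ is a skew translation generalized quadrangle. In particular, $x$ is a regular point.
   Context: A finite generalized quadrangle (GQ) of order $(s,t)$: every line has $s+1$ points, every point is on $t+1$ lines, two points are on at most one common line, and for each point $p$ not on a line $L$ there is a unique point of $L$ collinear with $p$. An elation generalized quadrangle (EGQ) $(\mathcal{S}^x,H)$: $H\le\mathrm{Aut}(\mathcal{S})$ fixes every line through $x$ and acts sharply transitively on the points not collinear with $x$. A symmetry about $x$ is an automorphism fixing every point collinear with $x$; the EGQ is a skew translation generalized quadrangle if $H$ contains a subgroup of $t$ symmetries about $x$. Property ( * ): whenever a point $y\neq x$ collinear with $x$ is fixed by some element $h\in H$, then $h$ fixes every point of the line $xy$. For a set $X$ of points, $X^\perp$ is the set of points collinear with every element of $X$ (a point is collinear with itself). A point $x$ is regular if for every point $y$ not collinear with $x$ one has $|\{x,y\}^{\perp\perp}|=t+1$. *)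

theory Defs
  imports Main
begin

definition collinear :: "'l set \<Rightarrow> ('p \<Rightarrow> 'l \<Rightarrow> bool) \<Rightarrow> 'p \<Rightarrow> 'p \<Rightarrow> bool" where
  "collinear Ls I p q \<longleftrightarrow> (\<exists>L\<in>Ls. I p L \<and> I q L)"

definition GQ :: "'p set \<Rightarrow> 'l set \<Rightarrow> ('p \<Rightarrow> 'l \<Rightarrow> bool) \<Rightarrow> nat \<Rightarrow> nat \<Rightarrow> bool" where
  "GQ P Ls I s t \<longleftrightarrow>
     finite P \<and> finite Ls \<and> s \<ge> 1 \<and> t \<ge> 1 \<and>
     (\<forall>p L. I p L \<longrightarrow> p \<in> P \<and> L \<in> Ls) \<and>
     (\<forall>L\<in>Ls. card {p\<in>P. I p L} = s + 1) \<and>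
     (\<forall>p\<in>P. card {L\<in>Ls. I p L} = t + 1) \<and>
     (\<forall>p\<in>P. \<forall>q\<in>P. p \<noteq> q \<longrightarrow>
        (\<forall>L\<in>Ls. \<forall>M\<in>Ls. I p L \<and> I q L \<and> I p M \<and> I q M \<longrightarrow> L = M)) \<and>
     (\<forall>p\<in>P. \<forall>L\<in>Ls. \<not> I p L \<longrightarrow> (\<exists>!q. q \<in> P \<and> I q L \<and> collinear Ls I p q))"

definition automorphism :: "'p set \<Rightarrow> 'l set \<Rightarrow> ('p \<Rightarrow> 'l \<Rightarrow> bool)
    \<Rightarrow> ('p \<Rightarrow> 'p) \<times> ('l \<Rightarrow> 'l) \<Rightarrow> bool" where
  "automorphism P Ls I h \<longleftrightarrow>
     bij_betw (fst h) P P \<and> bij_betw (snd h) Ls Ls \<and>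
     (\<forall>p. p \<notin> P \<longrightarrow> fst h p = p) \<and> (\<forall>L. L \<notin> Ls \<longrightarrow> snd h L = L) \<and>
     (\<forall>p\<in>P. \<forall>L\<in>Ls. I (fst h p) (snd h L) \<longleftrightarrow> I p L)"

definition ext_inv :: "'a set \<Rightarrow> ('a \<Rightarrow> 'a) \<Rightarrow> 'a \<Rightarrow> 'a" where
  "ext_inv A f = (\<lambda>y. if y \<in> A then inv_into A f y else y)"

definition aut_comp :: "('p \<Rightarrow> 'p) \<times> ('l \<Rightarrow> 'l) \<Rightarrow> ('p \<Rightarrow> 'p) \<times> ('l \<Rightarrow> 'l)
    \<Rightarrow> ('p \<Rightarrow> 'p) \<times> ('l \<Rightarrow> 'l)" where
  "aut_comp g h = (fst g \<circ> fst h, snd g \<circ> snd h)"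

definition aut_inv :: "'p set \<Rightarrow> 'l set \<Rightarrow> ('p \<Rightarrow> 'p) \<times> ('l \<Rightarrow> 'l) \<Rightarrow> ('p \<Rightarrow> 'p) \<times> ('l \<Rightarrow> 'l)" where
  "aut_inv P Ls h = (ext_inv P (fst h), ext_inv Ls (snd h))"

definition aut_subgroup :: "'p set \<Rightarrow> 'l set \<Rightarrow> ('p \<Rightarrow> 'l \<Rightarrow> bool)
    \<Rightarrow> (('p \<Rightarrow> 'p) \<times> ('l \<Rightarrow> 'l)) set \<Rightarrow> bool" where
  "aut_subgroup P Ls I H \<longleftrightarrow>
     (\<forall>h\<in>H. automorphism P Ls I h) \<and> (id, id) \<in> H \<and>
     (\<forall>g\<in>H. \<forall>h\<in>H. aut_comp g h \<in> H) \<and> (\<forall>h\<in>H. aut_inv P Ls h \<in> H)"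

definition EGQ :: "'p set \<Rightarrow> 'l set \<Rightarrow> ('p \<Rightarrow> 'l \<Rightarrow> bool) \<Rightarrow> nat \<Rightarrow> nat \<Rightarrow> 'p
    \<Rightarrow> (('p \<Rightarrow> 'p) \<times> ('l \<Rightarrow> 'l)) set \<Rightarrow> bool" where
  "EGQ P Ls I s t x H \<longleftrightarrow>
     GQ P Ls I s t \<and> x \<in> P \<and> aut_subgroup P Ls I H \<and>
     (\<forall>h\<in>H. \<forall>L\<in>Ls. I x L \<longrightarrow> snd h L = L) \<and>
     (\<forall>y\<in>P. \<forall>z\<in>P. \<not> collinear Ls I x y \<longrightarrow> \<not> collinear Ls I x z \<longrightarrow>
        (\<exists>!h. h \<in> H \<and> fst h y = z))"

definition symmetry_about :: "'p set \<Rightarrow> 'l set \<Rightarrow> ('p \<Rightarrow> 'l \<Rightarrow> bool) \<Rightarrow> 'p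
    \<Rightarrow> ('p \<Rightarrow> 'p) \<times> ('l \<Rightarrow> 'l) \<Rightarrow> bool" where
  "symmetry_about P Ls I x h \<longleftrightarrow>
     automorphism P Ls I h \<and> (\<forall>y\<in>P. collinear Ls I x y \<longrightarrow> fst h y = y)"

definition STGQ :: "'p set \<Rightarrow> 'l set \<Rightarrow> ('p \<Rightarrow> 'l \<Rightarrow> bool) \<Rightarrow> nat \<Rightarrow> nat \<Rightarrow> 'p
    \<Rightarrow> (('p \<Rightarrow> 'p) \<times> ('l \<Rightarrow> 'l)) set \<Rightarrow> bool" where
  "STGQ P Ls I s t x H \<longleftrightarrow>
     EGQ P Ls I s t x H \<and>
     (\<exists>S. S \<subseteq> H \<and> aut_subgroup P Ls I S \<and> card S = t \<and>
          (\<forall>h\<in>S. symmetry_about P Ls I x h))"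

definition property_star :: "'p set \<Rightarrow> 'l set \<Rightarrow> ('p \<Rightarrow> 'l \<Rightarrow> bool) \<Rightarrow> 'p
    \<Rightarrow> (('p \<Rightarrow> 'p) \<times> ('l \<Rightarrow> 'l)) set \<Rightarrow> bool" where
  "property_star P Ls I x H \<longleftrightarrow>
     (\<forall>y\<in>P. y \<noteq> x \<longrightarrow> collinear Ls I x y \<longrightarrow>
        (\<forall>h\<in>H. fst h y = y \<longrightarrow>
           (\<forall>L\<in>Ls. I x L \<and> I y L \<longrightarrow> (\<forall>z\<in>P. I z L \<longrightarrow> fst h z = z))))"

definition perp :: "'p set \<Rightarrow> 'l set \<Rightarrow> ('p \<Rightarrow> 'l \<Rightarrow> bool) \<Rightarrow> 'p set \<Rightarrow> 'p set" where
  "perp P Ls I X = {p\<in>P. \<forall>q\<in>X. collinear Ls I p q}"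

definition regular_point :: "'p set \<Rightarrow> 'l set \<Rightarrow> ('p \<Rightarrow> 'l \<Rightarrow> bool) \<Rightarrow> nat \<Rightarrow> 'p \<Rightarrow> bool" where
  "regular_point P Ls I t x \<longleftrightarrow>
     (\<forall>y\<in>P. \<not> collinear Ls I x y \<longrightarrow> card (perp P Ls I (perp P Ls I {x, y})) = t + 1)"

end

theory Submission
  imports Defs
begin

text \<open>
  Let \<open>a\<close>, \<open>b\<close> be noncollinear points collinear with both \<open>x\<close> and \<open>y\<close>, and let \<open>h \<in> H\<close> map \<open>y\<close> to
  another point \<open>y' \<noteq> x\<close> collinear with \<open>a\<close> and \<open>b\<close>. Then \<open>h\<close> fixes \<open>a\<close> and \<open>b\<close>, hence by (*) the
  lines \<open>xa\<close> and \<open>xb\<close> pointwise, so by the absence of triangles it maps no point \<open>w\<close> not collinear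
  with \<open>x\<close> to a point collinear with \<open>w\<close>. In a quadrangle of order \<open>(t\<^sup>2, t)\<close> any three pairwise
  disjoint lines have exactly \<open>t + 1\<close> transversals, and this forces \<open>h\<close> to be a symmetry. The
  \<open>t\<close> choices of \<open>y'\<close> (including \<open>y\<close>) give the \<open>t\<close> symmetries.
\<close>

section \<open>Incidence, absence of triangles and duality\<close>

locale gen_quad =
  fixes P :: "'p set" and Ls :: "'l set" and I :: "'p \<Rightarrow> 'l \<Rightarrow> bool" and s t :: nat
  assumes GQ: "GQ P Ls I s t"
begin

abbreviation col :: "'p \<Rightarrow> 'p \<Rightarrow> bool" where
  "col \<equiv> collinear Ls I"

lemma fin_P: "finite P" and fin_Ls: "finite Ls" and s_pos: "s \<ge> 1" and t_pos: "t \<ge> 1"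
  using GQ by (auto simp: GQ_def)

lemma incP: "I p L \<Longrightarrow> p \<in> P" and incL: "I p L \<Longrightarrow> L \<in> Ls"
  using GQ by (auto simp: GQ_def)

lemma card_points: "L \<in> Ls \<Longrightarrow> card {p. I p L} = s + 1"
proof -
  assume "L \<in> Ls"
  then have "card {p\<in>P. I p L} = s + 1" using GQ by (auto simp: GQ_def)
  moreover have "{p\<in>P. I p L} = {p. I p L}" using incP by auto
  ultimately show ?thesis by simp
qed

lemma card_lines: "p \<in> P \<Longrightarrow> card {L. I p L} = t + 1"
proof -
  assume "p \<in> P"
  then have "card {L\<in>Ls. I p L} = t + 1" using GQ by (auto simp: GQ_def)
  moreover have "{L\<in>Ls. I p L} = {L. I p L}" using incL by auto
  ultimately show ?thesis by simp
qed

lemma finite_points: "finite {p. I p L}"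
  by (rule finite_subset[OF _ fin_P]) (auto dest: incP)

lemma finite_lines: "finite {L. I p L}"
  by (rule finite_subset[OF _ fin_Ls]) (auto dest: incL)

lemma line_unique: "I p L \<Longrightarrow> I q L \<Longrightarrow> I p M \<Longrightarrow> I q M \<Longrightarrow> p \<noteq> q \<Longrightarrow> L = M"
  using GQ incP incL unfolding GQ_def by (elim conjE) meson

lemma colI: "I p L \<Longrightarrow> I q L \<Longrightarrow> col p q"
  using incL by (auto simp: collinear_def)

lemma colE:
  assumes "col p q"
  obtains L where "I p L" "I q L"
  using assms by (auto simp: collinear_def)

lemma col_sym: "col p q \<longleftrightarrow> col q p"
  by (auto simp: collinear_def)

lemma line_through:
  assumes "p \<in> P" obtains L where "I p L"
proof -
  have "{L. I p L} \<noteq> {}" using card_lines[OF assms] by (metis card.empty add_is_0 one_neq_zero)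
  then show ?thesis using that by auto
qed

lemma second_line_through:
  assumes "p \<in> P" obtains M where "I p M" "M \<noteq> L"
proof -
  have "\<not> {L. I p L} \<subseteq> {L}"
  proof
    assume "{L. I p L} \<subseteq> {L}"
    then have "card {L. I p L} \<le> 1" using card_mono[of "{L}"] by simp
    then show False using card_lines[OF assms] t_pos by simp
  qed
  then show ?thesis using that by auto
qed

lemma col_refl: "p \<in> P \<Longrightarrow> col p p"
  by (metis line_through colI)

lemma col_P: "col p q \<Longrightarrow> p \<in> P \<and> q \<in> P"
  using incP by (auto simp: collinear_def)

lemma finite_col: "finite {z. col x z \<and> Q z}"
  by (rule finite_subset[OF _ fin_P]) (auto dest: col_P)

lemma proj_ex1: "p \<in> P \<Longrightarrow> L \<in> Ls \<Longrightarrow> \<not> I p L \<Longrightarrow> \<exists>!q. q \<in> P \<and> I q L \<and> col p q"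
  using GQ unfolding GQ_def by (elim conjE) blast

text \<open>A point on \<open>L\<close> counts as its own projection, which keeps case distinctions
  out of later arguments.\<close>

lemma proj_ex:
  assumes "p \<in> P" "L \<in> Ls" obtains q where "I q L" "col p q"
  using proj_ex1[OF assms] col_refl[OF assms(1)] that by blast

lemma no_triangle:
  assumes "\<not> I p L" "I q L" "col p q" "I r L" "col p r"
  shows "q = r"
proof -
  have "p \<in> P" "L \<in> Ls" "q \<in> P" "r \<in> P" using assms col_P incL by blast+
  then show ?thesis using proj_ex1[of p L] assms by blast
qed

text \<open>Distinct \<open>A\<close> and \<open>B\<close> would make \<open>p\<close>,
  \<open>q\<close>, \<open>r\<close> a triangle, or would share two points if
  \<open>q = r\<close>.\<close>

lemma col_lines_eq:
  assumes "I p A" "I q A" "I p B" "I r B" "col q r" "q \<noteq> p" "r \<noteq> p"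
  shows "A = B"
  using assms no_triangle[of q B p r] line_unique[of p A q B] colI[of q A p] by blast

text \<open>The projection axiom is self-dual: the only line through \<open>p\<close> meeting
  \<open>L\<close> joins \<open>p\<close> to its projection on \<open>L\<close>.\<close>

lemma GQ_dual: "GQ Ls P (\<lambda>L p. I p L) t s"
proof -
  have ex1: "\<exists>!M. M \<in> Ls \<and> I p M \<and> collinear P (\<lambda>L p. I p L) L M"
    if L: "L \<in> Ls" "p \<in> P" "\<not> I p L" for L p
  proof -
    obtain q where q: "I q L" "col p q" using proj_ex[OF L(2,1)] by blast
    then obtain M where M: "I p M" "I q M" by (auto elim: colE)
    show ?thesis
    proof (rule ex1I[of _ M])
      show "M \<in> Ls \<and> I p M \<and> collinear P (\<lambda>L p. I p L) L M"
        using M q incL incP by (auto simp: collinear_def)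
      fix N assume N: "N \<in> Ls \<and> I p N \<and> collinear P (\<lambda>L p. I p L) L N"
      then obtain r where r: "I r L" "I r N" by (auto simp: collinear_def)
      have "q = r" using no_triangle[OF L(3) q(1,2) r(1)] colI N r by blast
      then show "N = M" using line_unique[of p N q M] N M r q L(3) by blast
    qed
  qed
  have "{p \<in> Ls. I L p} = {p. I L p}" "{L \<in> P. I L p} = {L. I L p}" for p L
    using incL incP by auto
  then show ?thesis unfolding GQ_def
    using fin_P fin_Ls s_pos t_pos incP incL card_points card_lines ex1
      line_unique by (auto; metis)
qed

section \<open>Counting points by collinearity with a given point\<close>

lemma card_pencil:
  assumes B: "\<And>L. L \<in> B \<Longrightarrow> I p L"
  shows "card {z. z \<noteq> p \<and> (\<exists>L\<in>B. I z L)} = s * card B"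
proof -
  have fB: "finite B" by (rule finite_subset[OF _ fin_Ls]) (auto dest: B incL)
  have "{z. z \<noteq> p \<and> (\<exists>L\<in>B. I z L)} = (\<Union>L\<in>B. {z. I z L} - {p})" by auto
  also have "card \<dots> = (\<Sum>L\<in>B. card ({z. I z L} - {p}))"
    using fB finite_points B by (intro card_UN_disjoint) (auto, metis line_unique)
  also have "\<dots> = (\<Sum>L\<in>B. s)"
    using B card_points[OF incL[OF B]] by (intro sum.cong) (simp_all add: card_Diff_singleton)
  finally show ?thesis by simp
qed

lemma card_pencil_diff:
  assumes "p \<in> P" and B: "\<And>L. L \<in> B \<Longrightarrow> I p L"
  shows "card {z. z \<noteq> p \<and> (\<exists>L. I p L \<and> L \<notin> B \<and> I z L)} = s * (t + 1 - card B)"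
proof -
  have "card ({L. I p L} - B) = t + 1 - card B"
    using B card_lines[OF assms(1)] finite_lines
    by (subst card_Diff_subset) (auto intro: finite_subset[OF _ finite_lines])
  then show ?thesis using card_pencil[of "{L. I p L} - B" p] by (simp add: conj_ac Bex_def)
qed

lemma card_col:
  assumes "p \<in> P" shows "card {z. col p z} = s * (t + 1) + 1"
proof -
  have "{z. col p z} = insert p {z. z \<noteq> p \<and> (\<exists>L. I p L \<and> L \<notin> {} \<and> I z L)}"
    using col_refl[OF assms] by (auto elim: colE intro: colI)
  moreover have "finite {z. z \<noteq> p \<and> (\<exists>L. I p L \<and> L \<notin> {} \<and> I z L)}"
    by (rule finite_subset[OF _ fin_P]) (auto dest: incP)
  ultimately show ?thesis using card_pencil_diff[OF assms, of "{}"] by simp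
qed

text \<open>Every line through \<open>x\<close> carries exactly one point collinear with
  \<open>y\<close>. None of these is \<open>x\<close>, the only point that two such lines
  share.\<close>

lemma card_centers:
  assumes "x \<in> P" "y \<in> P" "\<not> col x y"
  shows "card {w. col x w \<and> col y w} = t + 1"
proof -
  have nI: "\<not> I y L" if "I x L" for L using that assms colI by blast
  have "\<forall>L. \<exists>q. I x L \<longrightarrow> I q L \<and> col y q"
    using proj_ex[OF assms(2)] incL by blast
  from choice[OF this] obtain f where f: "\<And>L. I x L \<Longrightarrow> I (f L) L" "\<And>L. I x L \<Longrightarrow> col y (f L)" by blast
  have fx: "f L \<noteq> x" if "I x L" for L using f[OF that] assms col_sym by metis
  have "bij_betw f {L. I x L} {w. col x w \<and> col y w}"
  proof (rule bij_betw_imageI)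
    show "inj_on f {L. I x L}"
      by (rule inj_onI) (metis f(1) fx line_unique mem_Collect_eq)
    show "f ` {L. I x L} = {w. col x w \<and> col y w}"
    proof (intro set_eqI iffI)
      fix w assume "w \<in> {w. col x w \<and> col y w}"
      then obtain L where L: "I x L" "I w L" "col y w" by (auto elim: colE)
      then have "w = f L" using no_triangle[OF nI[OF L(1)] L(2,3) f[OF L(1)]] by simp
      then show "w \<in> f ` {L. I x L}" using L by auto
    qed (use f colI in auto)
  qed
  then show ?thesis using card_lines[OF assms(1)] bij_betw_same_card by metis
qed

text \<open>Absence of triangles would force a line through \<open>w\<close> and \<open>w'\<close>
  to contain both \<open>x\<close> and \<open>y\<close>.\<close>

lemma centers_not_col:
  assumes "\<not> col x y" "col x w" "col y w" "col x w'" "col y w'" "w \<noteq> w'"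
  shows "\<not> col w w'"
proof
  assume "col w w'"
  then obtain L where L: "I w L" "I w' L" by (auto elim: colE)
  have "I x L" using no_triangle[of x L w w'] L assms by blast
  moreover have "I y L" using no_triangle[of y L w w'] L assms by blast
  ultimately show False using colI assms by blast
qed

text \<open>Fix a line \<open>L\<close> through \<open>x\<close> and sort the points by their
  projection \<open>q\<close> to \<open>L\<close>: each of the \<open>s\<close> points
  \<open>q \<noteq> x\<close> accounts for the \<open>s * t\<close> points on its other
  lines.\<close>

lemma card_noncol:
  assumes "x \<in> P"
  shows "card {z\<in>P. \<not> col x z} = s * (s * t)"
proof -
  obtain L where L: "I x L" using line_through[OF assms] by blast
  let ?C = "\<lambda>q. {z. z \<noteq> q \<and> (\<exists>M. I q M \<and> M \<notin> {L} \<and> I z M)}"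
  have nL: "\<not> I z L" if "z \<in> ?C q" "I q L" for z q using that line_unique by blast
  have eq: "{z\<in>P. \<not> col x z} = (\<Union>q\<in>{q. I q L} - {x}. ?C q)"
  proof (intro set_eqI iffI)
    fix z assume z: "z \<in> {z\<in>P. \<not> col x z}"
    then have nz: "\<not> I z L" using L colI by blast
    obtain q where q: "I q L" "col z q" using proj_ex[of z L] z L incL by blast
    then obtain M where M: "I z M" "I q M" by (auto elim: colE)
    have "q \<noteq> x" using q z col_sym by blast
    moreover have "z \<noteq> q" "M \<noteq> L" using nz q M by blast+
    ultimately show "z \<in> (\<Union>q\<in>{q. I q L} - {x}. ?C q)" using M q by auto
  next
    fix z assume "z \<in> (\<Union>q\<in>{q. I q L} - {x}. ?C q)"
    then obtain q where q: "I q L" "q \<noteq> x" "z \<in> ?C q" by auto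
    have "col z q" using q(3) colI by blast
    then have "\<not> col x z" using no_triangle[OF nL[OF q(3,1)] q(1) _ L] q(2) col_sym by blast
    then show "z \<in> {z\<in>P. \<not> col x z}" using q incP by auto
  qed
  have disj: "?C q \<inter> ?C r = {}" if "I q L" "I r L" "q \<noteq> r" for q r
  proof (rule ccontr)
    assume "?C q \<inter> ?C r \<noteq> {}"
    then obtain z where z: "z \<in> ?C q" "z \<in> ?C r" by auto
    then have "col z q" "col z r" using colI by blast+
    then show False using no_triangle[OF nL[OF z(1) that(1)] that(1) _ that(2)] that(3) by blast
  qed
  have "card {z\<in>P. \<not> col x z} = (\<Sum>q\<in>{q. I q L} - {x}. card (?C q))"
    unfolding eq
  proof (rule card_UN_disjoint)
    show "\<forall>i\<in>{q. I q L} - {x}. finite (?C i)"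
      by (intro ballI finite_subset[OF _ fin_P]) (auto dest: incP)
  qed (use finite_points disj in blast)+
  also have "\<dots> = (\<Sum>q\<in>{q. I q L} - {x}. s * t)"
    by (rule sum.cong[OF refl], subst card_pencil_diff) (auto dest: incP)
  also have "\<dots> = s * (s * t)"
    using card_points[OF incL[OF L]] L by (simp add: card_Diff_singleton)
  finally show ?thesis .
qed

section \<open>Triads and their centers\<close>

lemma card_noncol2:
  assumes "x \<in> P" "y \<in> P" "\<not> col x y"
  shows "int (card {z\<in>P. \<not> col x z \<and> \<not> col y z}) = int s * int s * int t - int s * int t + int t - int s"
proof -
  let ?W = "{w. col x w \<and> col y w}" and ?Y = "{z. col y z}"
  have fY: "finite ?Y" using finite_col[of y "\<lambda>_. True"] by simp
  have W: "?W \<subseteq> ?Y" by auto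
  have Y: "?Y - ?W \<subseteq> {z\<in>P. \<not> col x z}" using col_P by auto
  have "{z\<in>P. \<not> col x z \<and> \<not> col y z} = {z\<in>P. \<not> col x z} - (?Y - ?W)" by auto
  then have "int (card {z\<in>P. \<not> col x z \<and> \<not> col y z}) = int (card {z\<in>P. \<not> col x z}) - int (card (?Y - ?W))"
    using card_Diff_subset[OF _ Y] card_mono[OF _ Y] fY fin_P by simp
  moreover have "int (card (?Y - ?W)) = int (card ?Y) - int (card ?W)"
    using card_Diff_subset[OF _ W] card_mono[OF _ W] fY finite_subset[OF W fY] by simp
  ultimately show ?thesis
    using card_noncol[OF assms(1)] card_col[OF assms(2)] card_centers[OF assms]
    by (simp add: algebra_simps)
qed

text \<open>These points lie on the \<open>t - 1\<close> lines through \<open>w\<close> other than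
  \<open>wx\<close> and \<open>wy\<close>, each of which has \<open>s\<close> points besides
  \<open>w\<close>.\<close>

lemma card_noncol2_col:
  assumes "\<not> col x y" "col x w" "col y w"
  shows "card {z\<in>P. \<not> col x z \<and> \<not> col y z \<and> col z w} = s * (t - 1)"
proof -
  obtain A B where A: "I x A" "I w A" and B: "I y B" "I w B" using assms by (auto elim!: colE)
  have ne: "A \<noteq> B" using A B assms colI by blast
  have wxy: "w \<noteq> x" "w \<noteq> y" using assms col_sym by blast+
  have "{z\<in>P. \<not> col x z \<and> \<not> col y z \<and> col z w}
      = {z. z \<noteq> w \<and> (\<exists>L. I w L \<and> L \<notin> {A, B} \<and> I z L)}" (is "?l = ?r")
  proof (intro set_eqI iffI)
    fix z assume z: "z \<in> ?l"
    then obtain L where L: "I z L" "I w L" by (auto elim: colE)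
    have "z \<noteq> w" "L \<noteq> A" "L \<noteq> B" using z assms L A B colI by blast+
    then show "z \<in> ?r" using L by auto
  next
    fix z assume "z \<in> ?r"
    then obtain L where L: "z \<noteq> w" "I w L" "L \<noteq> A" "L \<noteq> B" "I z L" by auto
    have "\<not> col x z" using col_lines_eq[OF A(2,1) L(2,5)] wxy L by auto
    moreover have "\<not> col y z" using col_lines_eq[OF B(2,1) L(2,5)] wxy L by auto
    ultimately show "z \<in> ?l" using L incP colI by auto
  qed
  moreover have "card {A, B} = 2" using ne by simp
  ultimately show ?thesis using card_pencil_diff[of w "{A, B}"] A B incP by auto
qed

text \<open>The noncollinear pair \<open>w\<close>, \<open>w'\<close> has \<open>t + 1\<close>
  common neighbours, pairwise noncollinear. Two of them are \<open>x\<close> and \<open>y\<close>;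
  all the others are counted.\<close>

lemma card_noncol2_col2:
  assumes "\<not> col x y" "col x w" "col y w" "col x w'" "col y w'" "w \<noteq> w'"
  shows "card {z\<in>P. \<not> col x z \<and> \<not> col y z \<and> col z w \<and> col z w'} = t - 1"
proof -
  have nw: "\<not> col w w'" using centers_not_col assms by blast
  have P: "x \<in> P" "y \<in> P" "w \<in> P" "w' \<in> P" using assms col_P by blast+
  have ne: "x \<noteq> y" using assms col_refl P by blast
  have "{z\<in>P. \<not> col x z \<and> \<not> col y z \<and> col z w \<and> col z w'} = {z. col w z \<and> col w' z} - {x, y}"
    (is "?l = ?r")
  proof (intro set_eqI iffI)
    fix z assume "z \<in> ?l"
    then show "z \<in> ?r" using col_refl P col_sym by blast
  next
    fix z assume "z \<in> ?r"
    then show "z \<in> ?l"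
      using centers_not_col[OF nw, of x z] centers_not_col[OF nw, of y z] assms col_sym col_P
      by blast
  qed
  moreover have "{x, y} \<subseteq> {z. col w z \<and> col w' z}" using assms col_sym by blast
  ultimately show ?thesis using card_Diff_subset[of "{x, y}"] card_centers[OF P(3,4) nw] ne by simp
qed

text \<open>
  Vanishing variance: over the points \<open>z\<close> collinear with neither \<open>x\<close> nor \<open>y\<close>, the sum of
  \<open>(c z - (s + 1))\<^sup>2\<close> is zero, where \<open>c z\<close> is the number of centers of the triad \<open>{x, y, z}\<close>.
\<close>
lemma card_triad_centers:
  assumes t: "t = s\<^sup>2" and P: "x \<in> P" "y \<in> P" "z \<in> P"
    and nc: "\<not> col x y" "\<not> col x z" "\<not> col y z"
  shows "card {w. col x w \<and> col y w \<and> col z w} = s + 1"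
proof -
  let ?W = "{w. col x w \<and> col y w}" and ?V = "{z\<in>P. \<not> col x z \<and> \<not> col y z}"
  define b where "b z w = (if col z w then 1 else 0 :: int)" for z w
  define c where "c z = (\<Sum>w\<in>?W. b z w)" for z
  have fW: "finite ?W" by (rule finite_col)
  have fV: "finite ?V" using fin_P by simp
  have cW: "int (card ?W) = int t + 1" using card_centers[OF P(1,2) nc(1)] by simp
  have c: "c z = int (card {w. col x w \<and> col y w \<and> col z w})" for z
  proof -
    have "c z = int (card (?W \<inter> {w. col z w}))"
      unfolding c_def b_def using fW by (simp add: sum.If_cases)
    also have "?W \<inter> {w. col z w} = {w. col x w \<and> col y w \<and> col z w}" by auto
    finally show ?thesis .
  qed
  have b1: "(\<Sum>z\<in>?V. b z w) = int s * (int t - 1)" if "w \<in> ?W" for w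
  proof -
    have "(\<Sum>z\<in>?V. b z w) = int (card (?V \<inter> {z. col z w}))"
      unfolding b_def using fV by (simp add: sum.If_cases)
    also have "?V \<inter> {z. col z w} = {z\<in>P. \<not> col x z \<and> \<not> col y z \<and> col z w}" by auto
    finally show ?thesis using card_noncol2_col[OF nc(1), of w] that t_pos by (simp add: of_nat_diff)
  qed
  have b2: "(\<Sum>z\<in>?V. b z w * b z w') = int t - 1" if "w \<in> ?W" "w' \<in> ?W - {w}" for w w'
  proof -
    have "(\<Sum>z\<in>?V. b z w * b z w') = (\<Sum>z\<in>?V. if col z w \<and> col z w' then 1 else 0)"
      unfolding b_def by (rule sum.cong) auto
    also have "\<dots> = int (card (?V \<inter> {z. col z w \<and> col z w'}))"
      using fV by (simp add: sum.If_cases)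
    also have "?V \<inter> {z. col z w \<and> col z w'} = {z\<in>P. \<not> col x z \<and> \<not> col y z \<and> col z w \<and> col z w'}"
      by auto
    finally show ?thesis
      using card_noncol2_col2[OF nc(1), of w w'] that t_pos by (auto simp add: of_nat_diff)
  qed
  \<comment> \<open>Pairs of a point \<open>z\<close> and a center \<open>w\<close> of
    \<open>{x, y, z}\<close>, counted from \<open>w\<close>.\<close>
  have S1: "(\<Sum>z\<in>?V. c z) = (int t + 1) * (int s * (int t - 1))"
  proof -
    have "(\<Sum>z\<in>?V. c z) = (\<Sum>w\<in>?W. \<Sum>z\<in>?V. b z w)" unfolding c_def by (rule sum.swap)
    also have "\<dots> = (\<Sum>w\<in>?W. int s * (int t - 1))" using b1 by (intro sum.cong) auto
    finally show ?thesis using cW by simp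
  qed
  \<comment> \<open>The same with ordered pairs of centers: for each \<open>w\<close>, the case
    \<open>w' = w\<close> gives the previous count and each of the \<open>t\<close> other choices
    gives \<open>t - 1\<close>.\<close>
  have S2: "(\<Sum>z\<in>?V. c z * c z) = (int t + 1) * (int s * (int t - 1) + int t * (int t - 1))"
  proof -
    have "(\<Sum>z\<in>?V. c z * c z) = (\<Sum>z\<in>?V. \<Sum>w\<in>?W. \<Sum>w'\<in>?W. b z w * b z w')"
      unfolding c_def sum_product ..
    also have "\<dots> = (\<Sum>w\<in>?W. \<Sum>z\<in>?V. \<Sum>w'\<in>?W. b z w * b z w')" by (rule sum.swap)
    also have "\<dots> = (\<Sum>w\<in>?W. \<Sum>w'\<in>?W. \<Sum>z\<in>?V. b z w * b z w')"
      by (intro sum.cong refl sum.swap)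
    also have "\<dots> = (\<Sum>w\<in>?W. int s * (int t - 1) + int t * (int t - 1))"
    proof (rule sum.cong[OF refl])
      fix w assume w: "w \<in> ?W"
      have "(\<Sum>w'\<in>?W. \<Sum>z\<in>?V. b z w * b z w')
          = (\<Sum>z\<in>?V. b z w * b z w) + (\<Sum>w'\<in>?W - {w}. \<Sum>z\<in>?V. b z w * b z w')"
        by (rule sum.remove[OF fW w])
      also have "(\<Sum>z\<in>?V. b z w * b z w) = (\<Sum>z\<in>?V. b z w)"
        by (rule sum.cong) (auto simp: b_def)
      also have "(\<Sum>w'\<in>?W - {w}. \<Sum>z\<in>?V. b z w * b z w') = (\<Sum>w'\<in>?W - {w}. int t - 1)"
        using b2[OF w] by (intro sum.cong) auto
      also have "\<dots> = int t * (int t - 1)"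
        using card_centers[OF P(1,2) nc(1)] w by (simp add: card_Diff_singleton)
      finally show "(\<Sum>w'\<in>?W. \<Sum>z\<in>?V. b z w * b z w') = int s * (int t - 1) + int t * (int t - 1)"
        using b1[OF w] by simp
    qed
    finally show ?thesis using cW by simp
  qed
  have "(\<Sum>z\<in>?V. (c z - (int s + 1))\<^sup>2)
      = (\<Sum>z\<in>?V. c z * c z - 2 * (int s + 1) * c z + (int s + 1)\<^sup>2)"
    by (intro sum.cong) (auto simp: power2_eq_square algebra_simps)
  also have "\<dots> = (\<Sum>z\<in>?V. c z * c z) - 2 * (int s + 1) * (\<Sum>z\<in>?V. c z) + int (card ?V) * (int s + 1)\<^sup>2"
    by (simp add: sum.distrib sum_subtractf sum_distrib_left)
  \<comment> \<open>With \<open>t = s\<^sup>2\<close> the three terms are \<open>1\<close>,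
    \<open>-2\<close> and \<open>1\<close> times \<open>s (s + 1) (s^4 - 1)\<close>.\<close>
  also have "\<dots> = 0"
    unfolding S1 S2 card_noncol2[OF P(1,2) nc(1)] t
    by (simp add: power2_eq_square algebra_simps)
  finally have "\<forall>z\<in>?V. (c z - (int s + 1))\<^sup>2 = 0"
    using sum_nonneg_eq_0_iff[OF fV, of "\<lambda>z. (c z - (int s + 1))\<^sup>2"] by simp
  then have "c z = int s + 1" using P nc by simp
  then show ?thesis using c[of z] by simp
qed

text \<open>In the dual quadrangle, of order \<open>(t, t\<^sup>2)\<close>, pairwise disjoint lines
  form a triad and their transversals are its centers.\<close>

lemma card_transversals:
  assumes "s = t\<^sup>2" "A \<in> Ls" "B \<in> Ls" "C \<in> Ls"
    and "\<nexists>p. I p A \<and> I p B" "\<nexists>p. I p A \<and> I p C" "\<nexists>p. I p B \<and> I p C"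
  shows "card {N. (\<exists>p. I p A \<and> I p N) \<and> (\<exists>p. I p B \<and> I p N) \<and> (\<exists>p. I p C \<and> I p N)} = t + 1"
proof -
  interpret dual: gen_quad Ls P "\<lambda>L p. I p L" t s
    by unfold_locales (rule GQ_dual)
  have "dual.col L M \<longleftrightarrow> (\<exists>p. I p L \<and> I p M)" for L M
    using incP by (auto simp: collinear_def)
  then show ?thesis using dual.card_triad_centers[of A B C] assms by simp
qed

section \<open>Automorphisms fixing two lines through a point pointwise\<close>

lemma aut_inc:
  assumes "automorphism P Ls I h"
  shows "I p L \<Longrightarrow> I (fst h p) (snd h L)"
  using assms incP incL by (auto simp: automorphism_def)

lemma aut_col:
  assumes "automorphism P Ls I h" "col p q"
  shows "col (fst h p) (fst h q)"
  using assms(2) aut_inc[OF assms(1)] by (meson colE colI)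

text \<open>A line \<open>N\<close> joining \<open>w\<close> to its image must contain every fixed
  point collinear with \<open>w\<close>. It would thus meet \<open>A\<close> and \<open>B\<close> in
  points that form a triangle with \<open>x\<close>.\<close>

lemma not_col_image:
  assumes aut: "automorphism P Ls I h"
    and A: "I x A" "\<And>z. I z A \<Longrightarrow> fst h z = z"
    and B: "I x B" "\<And>z. I z B \<Longrightarrow> fst h z = z" and "A \<noteq> B"
    and w: "w \<in> P" "\<not> col x w" "fst h w \<noteq> w"
  shows "\<not> col w (fst h w)"
proof
  assume "col w (fst h w)"
  then obtain N where N: "I w N" "I (fst h w) N" by (auto elim: colE)
  have on_N: "I a N" if "fst h a = a" "col w a" for a
    using no_triangle[of a N w "fst h w"] N aut_col[OF aut that(2)] that w(3) col_sym by metis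
  obtain a where a: "I a A" "col w a" using proj_ex[OF w(1) incL[OF A(1)]] .
  obtain b where b: "I b B" "col w b" using proj_ex[OF w(1) incL[OF B(1)]] .
  have "col a b" using on_N a b A B colI by metis
  moreover have "a \<noteq> x" "b \<noteq> x" using a b w col_sym by blast+
  ultimately show False using col_lines_eq[OF A(1) a(1) B(1) b(1)] \<open>A \<noteq> B\<close> by blast
qed

text \<open>
  If \<open>z\<close> were moved along the line \<open>C\<close>, then for a line \<open>M \<noteq> C\<close> through \<open>z\<close> the lines \<open>A\<close>, \<open>M\<close>
  and \<open>h M\<close> would be pairwise disjoint, so besides \<open>C\<close> they would have another transversal; it
  meets \<open>M\<close> in a point collinear with its image.
\<close>
lemma fixes_third_line:
  assumes s: "s = t\<^sup>2" and aut: "automorphism P Ls I h"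
    and A: "I x A" "\<And>z. I z A \<Longrightarrow> fst h z = z"
    and B: "I x B" "\<And>z. I z B \<Longrightarrow> fst h z = z" and "A \<noteq> B"
    and free: "\<And>w. w \<in> P \<Longrightarrow> \<not> col x w \<Longrightarrow> fst h w \<noteq> w"
    and C: "I x C" "snd h C = C" and z: "I z C"
  shows "fst h z = z"
proof (rule ccontr)
  assume moved: "fst h z \<noteq> z"
  have ncol: "\<not> col w (fst h w)" if "w \<in> P" "\<not> col x w" for w
    using not_col_image[OF aut A B \<open>A \<noteq> B\<close> that free[OF that]] .
  \<comment> \<open>\<open>x\<close> lies on \<open>A\<close> and is therefore fixed.\<close>
  have xz: "z \<noteq> x" "fst h z \<noteq> x"
    using moved A aut z incP unfolding automorphism_def bij_betw_def inj_on_def by metis+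
  have AC: "A \<noteq> C" using moved A z by blast
  obtain M where M: "I z M" "M \<noteq> C" using second_line_through[OF incP[OF z]] by metis
  define z' M' where "z' = fst h z" and "M' = snd h M"
  have M': "I z' M'" unfolding z'_def M'_def by (rule aut_inc[OF aut M(1)])
  have z': "I z' C" "z' \<noteq> x" "z' \<noteq> z" using aut_inc[OF aut z] C moved xz unfolding z'_def by auto
  have hM: "I (fst h w) M'" if "I w M" for w unfolding M'_def by (rule aut_inc[OF aut that])
  have M'C: "M' \<noteq> C"
  proof
    assume "M' = C"
    then have "snd h M = snd h C" using C unfolding M'_def by simp
    then show False using aut M C incL unfolding automorphism_def bij_betw_def inj_on_def by metis
  qed
  \<comment> \<open>\<open>x\<close> lies on neither \<open>M\<close> nor \<open>M'\<close>, so
    \<open>z\<close> and \<open>z'\<close> are its projections to these lines.\<close>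
  have onM: "w = z" if "I w M" "col x w" for w
    using that no_triangle[of x M w z] M z C xz colI line_unique[of x M z C] by metis
  have onM': "w = z'" if "I w M'" "col x w" for w
    using that no_triangle[of x M' w z'] M' M'C z' C colI line_unique[of x M' z' C] by metis
  have z_A: "\<not> I z A" "\<not> I z' A" using line_unique[of x A _ C] A C z z' xz AC by metis+
  have d1: "\<nexists>p. I p A \<and> I p M" using onM z_A colI A by metis
  have d2: "\<nexists>p. I p A \<and> I p M'" using onM' z_A colI A by metis
  have d3: "\<nexists>p. I p M \<and> I p M'"
  \<comment> \<open>A common point not collinear with \<open>x\<close> would share the line
    \<open>M'\<close> with its image; one collinear with \<open>x\<close> would force
    \<open>z = z'\<close>.\<close>
  proof
    assume "\<exists>p. I p M \<and> I p M'"
    then obtain w where w: "I w M" "I w M'" by blast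
    show False
    proof (cases "col x w")
      case True
      then show False using onM onM' w z' by metis
    next
      case False
      then show False using ncol[of w] w incP hM colI by metis
    qed
  qed
  let ?T = "{N. (\<exists>p. I p A \<and> I p N) \<and> (\<exists>p. I p M \<and> I p N) \<and> (\<exists>p. I p M' \<and> I p N)}"
  have "card ?T = t + 1" using card_transversals[OF s _ _ _ d1 d2 d3] incL A M M' by metis
  then have "\<not> ?T \<subseteq> {C}" using card_mono[of "{C}" ?T] t_pos by auto
  then obtain N v w w' where N: "N \<noteq> C" "I v A" "I v N" "I w M" "I w N" "I w' M'" "I w' N"
    by blast
  \<comment> \<open>Otherwise \<open>w = z\<close>, and \<open>N\<close> would complete a triangle
    \<open>x\<close>, \<open>z\<close>, \<open>v\<close>.\<close>
  have nw: "\<not> col x w"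
  proof
    assume "col x w"
    then have "I z N" using onM N by blast
    then have "col z v" using N colI by blast
    moreover have "v \<noteq> x" using N \<open>I z N\<close> C z xz line_unique by metis
    ultimately show False using col_lines_eq[OF A(1) N(2) C(1) z] xz AC col_sym by metis
  qed
  have "col v w" "col v w'" using N colI by blast+
  \<comment> \<open>\<open>v\<close> is fixed, being on \<open>A\<close>, so the image of
    \<open>w\<close> is collinear with \<open>v\<close>. So is \<open>w'\<close>, but
    \<open>v\<close> has only one neighbour on \<open>M'\<close>.\<close>
  then have "col v (fst h w)" using aut_col[OF aut, of v w] A N by metis
  then have "w' = fst h w"
    using no_triangle[of v M' w' "fst h w"] d2 N hM \<open>col v w'\<close> by metis
  then show False using ncol[OF incP[OF N(4)] nw] N colI by metis
qed

end

section \<open>The group of symmetries and the regularity of \<open>x\<close>\<close>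

lemma aut_subgroup_symmetries:
  assumes "aut_subgroup P Ls I H"
  shows "aut_subgroup P Ls I {h\<in>H. symmetry_about P Ls I x h}"
proof -
  have aut: "automorphism P Ls I h" if "h \<in> H" for h using assms that by (simp add: aut_subgroup_def)
  have "fst (aut_inv P Ls h) y = y"
    if "h \<in> H" "symmetry_about P Ls I x h" "y \<in> P" "collinear Ls I x y" for h y
    using that by (simp add: aut_inv_def ext_inv_def symmetry_about_def automorphism_def)
      (metis bij_betw_def inv_into_f_f)
  then show ?thesis
    using assms aut unfolding aut_subgroup_def by (auto simp: symmetry_about_def aut_comp_def)
qed

theorem mainTheorem4:
  fixes P :: "'p set" and Ls :: "'l set" and I :: "'p \<Rightarrow> 'l \<Rightarrow> bool"
    and t :: nat and x :: 'p and H :: "(('p \<Rightarrow> 'p) \<times> ('l \<Rightarrow> 'l)) set"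
  assumes "EGQ P Ls I (t^2) t x H"
    and "property_star P Ls I x H"
  shows "STGQ P Ls I (t^2) t x H \<and> regular_point P Ls I t x"
proof -
  interpret gen_quad P Ls I "t\<^sup>2" t
    using assms(1) by unfold_locales (simp add: EGQ_def)
  have x: "x \<in> P" and sub: "aut_subgroup P Ls I H"
    and line_fix: "\<And>h L. h \<in> H \<Longrightarrow> I x L \<Longrightarrow> snd h L = L"
    and sharp: "\<And>y z. y \<in> P \<Longrightarrow> z \<in> P \<Longrightarrow> \<not> col x y \<Longrightarrow> \<not> col x z \<Longrightarrow> \<exists>!h. h \<in> H \<and> fst h y = z"
    using assms(1) incL by (auto simp: EGQ_def)
  have aut: "automorphism P Ls I h" if "h \<in> H" for h using sub that by (simp add: aut_subgroup_def)
  have idH: "(id, id) \<in> H" using sub by (simp add: aut_subgroup_def)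
  \<comment> \<open>Taking all symmetries in \<open>H\<close> yields a subgroup at once; what
    remains is its order.\<close>
  define S where "S = {h\<in>H. symmetry_about P Ls I x h}"
  have S_H: "S \<subseteq> H" and S_sym: "\<And>h. h \<in> S \<Longrightarrow> symmetry_about P Ls I x h"
    unfolding S_def by auto
  obtain A where A: "I x A" using line_through[OF x] .
  obtain B where B: "I x B" "A \<noteq> B" using second_line_through[OF x] by metis

  \<comment> \<open>One bijection serves both claims: it gives the order of \<open>S\<close>, and it
    shows that the common neighbours of \<open>a\<close> and \<open>b\<close> other than
    \<open>x\<close> are the orbit of \<open>y\<close> under \<open>S\<close>.\<close>
  have key: "\<exists>a b. col x a \<and> col y a \<and> col x b \<and> col y b \<and> \<not> col a b \<and>
      bij_betw (\<lambda>h. fst h y) S ({v. col a v \<and> col b v} - {x})"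
    if y: "y \<in> P" "\<not> col x y" for y
  proof -
    obtain a where a: "I a A" "col y a" using proj_ex[OF y(1) incL[OF A]] .
    obtain b where b: "I b B" "col y b" using proj_ex[OF y(1) incL[OF B(1)]] .
    have ab: "col x a" "col x b" using a b A B colI by blast+
    have ne: "a \<noteq> x" "b \<noteq> x" using a b y col_sym by blast+
    have nab: "\<not> col a b" using col_lines_eq[OF A a(1) B(1) b(1)] ne B by blast
    have nx: "\<not> col x v" if "col a v" "col b v" "v \<noteq> x" for v
      using centers_not_col[OF nab] ab that col_sym by metis
    have sym: "h \<in> S" if h: "h \<in> H" "col a (fst h y)" "col b (fst h y)" "fst h y \<noteq> x" for h
    proof (cases "\<exists>w\<in>P. \<not> col x w \<and> fst h w = w")
      case True
      \<comment> \<open>Sharp transitivity leaves only the identity.\<close>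
      then have "h = (id, id)" using sharp idH h(1) by (metis fst_conv id_apply)
      then show ?thesis using idH sub by (simp add: S_def symmetry_about_def aut_subgroup_def)
    next
      case False
      \<comment> \<open>\<open>c\<close> stands for \<open>a\<close> or \<open>b\<close>. Both
        \<open>c\<close> and its image are the projection of \<open>fst h y\<close> to
        \<open>L\<close>, so \<open>c\<close> is fixed, and \<open>property_star\<close> extends
        this to all of \<open>L\<close>.\<close>
      have fixL: "fst h v = v" if "I c L" "I x L" "col y c" "c \<noteq> x" "col c (fst h y)" "I v L" for c L v
      proof -
        have "\<not> I (fst h y) L" using nx[OF h(2,3,4)] colI that by blast
        moreover have "I (fst h c) L" using aut_inc[OF aut[OF h(1)] that(1)] line_fix[OF h(1)] that by simp
        ultimately have "fst h c = c"
          using no_triangle[of "fst h y" L "fst h c" c] aut_col[OF aut[OF h(1)] that(3)] that col_sym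
          by metis
        then show ?thesis
          using assms(2) that h(1) incP incL colI unfolding property_star_def by metis
      qed
      have "fst h z = z" if "col x z" for z
      proof -
        obtain C where C: "I x C" "I z C" using \<open>col x z\<close> by (auto elim: colE)
        show ?thesis
          by (rule fixes_third_line[OF refl aut[OF h(1)] A _ B(1) _ B(2) _ C(1) line_fix[OF h(1) C(1)] C(2)])
            (use fixL[OF a(1) A a(2) ne(1) h(2)] fixL[OF b(1) B(1) b(2) ne(2) h(3)] False in auto)
      qed
      then show ?thesis using h aut by (auto simp: S_def symmetry_about_def)
    qed
    have "bij_betw (\<lambda>h. fst h y) S ({v. col a v \<and> col b v} - {x})"
    proof (rule bij_betw_imageI)
      \<comment> \<open>A symmetry fixes \<open>a\<close>, \<open>b\<close> and \<open>x\<close>: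
        the image of \<open>y\<close> stays collinear with \<open>a\<close> and \<open>b\<close>,
        and injectivity keeps it away from \<open>x\<close>.\<close>
      have img: "fst h y \<in> {v. col a v \<and> col b v} - {x}" if "h \<in> S" for h
      proof -
        have hH: "h \<in> H" and fix_x: "\<And>v. col x v \<Longrightarrow> fst h v = v"
          using that col_P by (auto simp: S_def symmetry_about_def)
        have "col (fst h y) a" "col (fst h y) b"
          using aut_col[OF aut[OF hH] a(2)] aut_col[OF aut[OF hH] b(2)] fix_x ab by auto
        moreover have "fst h y \<noteq> x"
        proof
          assume "fst h y = x"
          then have "fst h y = fst h x" using fix_x col_refl[OF x] by simp
          then have "y = x" using aut[OF hH] x y(1)
            unfolding automorphism_def bij_betw_def inj_on_def by metis
          then show False using y col_refl[OF x] by blast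
        qed
        ultimately show ?thesis using col_sym by blast
      qed
      show "inj_on (\<lambda>h. fst h y) S"
      proof (rule inj_onI)
        fix g h assume gh: "g \<in> S" "h \<in> S" "fst g y = fst h y"
        have "fst g y \<in> P" "\<not> col x (fst g y)" using img[OF gh(1)] nx col_P by blast+
        then have "\<exists>!k. k \<in> H \<and> fst k y = fst g y" using sharp[OF y(1) _ y(2)] by blast
        moreover have "g \<in> H" "h \<in> H" using gh S_H by auto
        ultimately show "g = h" using gh(3) by metis
      qed
      show "(\<lambda>h. fst h y) ` S = {v. col a v \<and> col b v} - {x}"
      proof (intro set_eqI iffI)
        fix v assume v: "v \<in> {v. col a v \<and> col b v} - {x}"
        then have "v \<in> P" "\<not> col x v" using nx col_P by blast+
        then obtain h where "h \<in> H" "fst h y = v" using sharp[OF y(1) _ y(2)] by metis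
        moreover from this have "h \<in> S" using sym[of h] v by simp
        ultimately show "v \<in> (\<lambda>h. fst h y) ` S" by blast
      qed (use img in auto)
    qed
    then show ?thesis using a b ab nab by blast
  qed

  have card_ab: "card {v. col a v \<and> col b v} = t + 1" if "col x a" "col x b" "\<not> col a b" for a b
    using card_centers that col_P by blast
  obtain y where y: "y \<in> P" "\<not> col x y"
  proof -
    have "{z\<in>P. \<not> col x z} \<noteq> {}" using card_noncol[OF x] s_pos t_pos by (metis card.empty mult_is_0 not_one_le_zero)
    then show ?thesis using that by auto
  qed
  have "card S = t"
  proof -
    obtain a b where ab: "col x a" "col x b" "\<not> col a b"
      "bij_betw (\<lambda>h. fst h y) S ({v. col a v \<and> col b v} - {x})" using key[OF y] by blast
    \<comment> \<open>\<open>x\<close> is one of the \<open>t + 1\<close> common neighbours, which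
      leaves \<open>t\<close> for the orbit.\<close>
    have "x \<in> {v. col a v \<and> col b v}" using ab col_sym by blast
    then show ?thesis
      using bij_betw_same_card[OF ab(4)] card_ab[OF ab(1-3)] by (simp add: card_Diff_singleton)
  qed
  moreover have "aut_subgroup P Ls I S" unfolding S_def by (rule aut_subgroup_symmetries[OF sub])
  ultimately have "STGQ P Ls I (t\<^sup>2) t x H"
    unfolding STGQ_def using assms(1) S_H S_sym by blast
  moreover have "regular_point P Ls I t x"
    unfolding regular_point_def
  proof (intro ballI impI)
    fix y assume y: "y \<in> P" "\<not> col x y"
    obtain a b where ab: "col x a" "col y a" "col x b" "col y b" "\<not> col a b"
      "bij_betw (\<lambda>h. fst h y) S ({v. col a v \<and> col b v} - {x})" using key[OF y] by blast
    have "perp P Ls I (perp P Ls I {x, y}) = {v. col a v \<and> col b v}"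
    proof (intro set_eqI iffI)
      fix v assume "v \<in> perp P Ls I (perp P Ls I {x, y})"
      then show "v \<in> {v. col a v \<and> col b v}"
        using ab col_sym col_P unfolding perp_def by blast
    next
      fix v assume v: "v \<in> {v. col a v \<and> col b v}"
      \<comment> \<open>\<open>w\<close> is fixed by \<open>S\<close>, hence collinear with the
        whole orbit of \<open>y\<close>; \<open>x\<close> lies outside that orbit and is treated
        apart.\<close>
      have "col v w" if w: "col w x" "col w y" for w
      proof (cases "v = x")
        case True
        then show ?thesis using w col_sym by blast
      next
        case False
        then obtain h where h: "h \<in> S" "v = fst h y" using v ab(6) unfolding bij_betw_def by blast
        then have "fst h w = w" using w S_sym col_sym col_P unfolding symmetry_about_def by metis
        then show ?thesis using aut_col[OF aut w(2), of h] h S_H col_sym by auto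
      qed
      then show "v \<in> perp P Ls I (perp P Ls I {x, y})" using v col_P unfolding perp_def by blast
    qed
    then show "card (perp P Ls I (perp P Ls I {x, y})) = t + 1" using card_ab ab by simp
  qed
  ultimately show ?thesis ..
qed

end
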